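(* Let $\mathcal{I},\mathcal{J}$ be admissible ideals on $\mathbf{N}$ and let $A=(a_{n,k})_{n,k\in\mathbf{N}}$ be an infinite real matrix. Suppose that at least one of the following holds: $A$ is nonnegative (i.e., $a_{n,k}\ge 0$ for all $n,k$), or $\mathcal{I}=\mathrm{Fin}$, or $\mathcal{J}=\mathrm{Fin}$. Then $A$ is $(\mathcal{I},\mathcal{J})$-regular if and only if all of the following hold: (T1) $\sup_n \sum_k |a_{n,k}| < \infty$; (T2) $\mathcal{J}\text{-}\lim_n \sum_k a_{n,k}=1$; (T3) $\mathcal{J}\text{-}\lim_n \sum_{k \in E} |a_{n,k}|=0$ for all $E \in \mathcal{I}$.
   Context: $\mathbf{N}$ is the set of positive integers and $\mathrm{Fin}$ is the family of finite subsets of $\mathbf{N}$. An ideal on $\mathbf{N}$ is a family of subsets of $\mathbf{N}$ closed under finite unions and under taking subsets; it is admissible if it contains $\mathrm{Fin}$ and is not equal to $\mathcal{P}(\mathbf{N})$. Let $\omega$ be the set of all real sequences indexed by $\mathbf{N}$. A sequence $x\in\omega$ is $\mathcal{I}$-convergent to $\eta\in\mathbf{R}$, written $\mathcal{I}\text{-}\lim x=\eta$ (or $\mathcal{I}\text{-}\lim_n x_n=\eta$), if $\{n\in\mathbf{N}: |x_n-\eta|>\varepsilon\}\in\mathcal{I}$ for all $\varepsilon>0$. $c(\mathcal{I})$ is the vector space of $\mathcal{I}$-convergent real sequences, and $\ell_\infty$ is the space of bounded real sequences. For an infinite real matrix $A=(a_{n,k})$ and $x\in\omega$, $Ax$ is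 the sequence $(\sum_k a_{n,k}x_k)_n$, which is well defined when all these series converge. For $X,Y\subseteq\omega$, $(X,Y)$ denotes the set of infinite real matrices $A$ such that $Ax$ is well defined and belongs to $Y$ for all $x\in X$. A matrix $A$ is $(\mathcal{I},\mathcal{J})$-regular if $A\in(c(\mathcal{I})\cap\ell_\infty,\,c(\mathcal{J})\cap\ell_\infty)$ and $\mathcal{I}\text{-}\lim x=\mathcal{J}\text{-}\lim Ax$ for all $x\in c(\mathcal{I})\cap\ell_\infty$. *)

theory Defs
  imports "HOL-Analysis.Analysis"
begin

text \<open>
  The index set \<open>\<^bold>N\<close> of positive integers is represented by the type \<^typ>\<open>nat\<close>, the
  number \<open>n\<close> standing for the index \<open>n + 1\<close>: this shift preserves the order, hence the meaning of
  all series involved.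
\<close>

definition set_ideal :: "'a set set \<Rightarrow> bool" where
  "set_ideal I \<longleftrightarrow>
     (\<forall>S\<in>I. \<forall>T\<in>I. S \<union> T \<in> I) \<and> (\<forall>S\<in>I. \<forall>T. T \<subseteq> S \<longrightarrow> T \<in> I)"

definition Fin :: "nat set set" where
  "Fin = {S. finite S}"

definition admissible_ideal :: "nat set set \<Rightarrow> bool" where
  "admissible_ideal I \<longleftrightarrow> set_ideal I \<and> Fin \<subseteq> I \<and> I \<noteq> UNIV"

definition ideal_tendsto :: "nat set set \<Rightarrow> (nat \<Rightarrow> real) \<Rightarrow> real \<Rightarrow> bool" where
  "ideal_tendsto I x \<eta> \<longleftrightarrow> (\<forall>\<epsilon>>0. {n. \<bar>x n - \<eta>\<bar> > \<epsilon>} \<in> I)"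

definition ideal_lim :: "nat set set \<Rightarrow> (nat \<Rightarrow> real) \<Rightarrow> real" where
  "ideal_lim I x = (THE \<eta>. ideal_tendsto I x \<eta>)"

lemma ideal_tendsto_unique:
  assumes I: "admissible_ideal I" and a: "ideal_tendsto I x a" and b: "ideal_tendsto I x b"
  shows "a = b"
proof (rule ccontr)
  assume "a \<noteq> b"
  define e where "e = \<bar>a - b\<bar> / 3"
  have "e > 0" using \<open>a \<noteq> b\<close> by (simp add: e_def)
  with a b have "{n. \<bar>x n - a\<bar> > e} \<in> I" "{n. \<bar>x n - b\<bar> > e} \<in> I"
    by (auto simp: ideal_tendsto_def)
  with I have "{n. \<bar>x n - a\<bar> > e} \<union> {n. \<bar>x n - b\<bar> > e} \<in> I"
    by (auto simp: admissible_ideal_def set_ideal_def)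
  also have "{n. \<bar>x n - a\<bar> > e} \<union> {n. \<bar>x n - b\<bar> > e} = UNIV"
  proof -
    have "\<bar>x n - a\<bar> > e \<or> \<bar>x n - b\<bar> > e" for n
    proof (rule ccontr)
      assume "\<not> ?thesis"
      then have "\<bar>a - b\<bar> \<le> 2 * e" by linarith
      moreover have "\<bar>a - b\<bar> = 3 * e" by (simp add: e_def)
      ultimately show False using \<open>e > 0\<close> by simp
    qed
    then show ?thesis by blast
  qed
  finally have "UNIV \<in> I" .
  then have "S \<in> I" for S
    using I unfolding admissible_ideal_def set_ideal_def by (meson subset_UNIV)
  then have "I = UNIV" by blast
  with I show False by (simp add: admissible_ideal_def)
qed

lemma ideal_lim_eqI:
  assumes "admissible_ideal I" and "ideal_tendsto I x \<eta>"
  shows "ideal_lim I x = \<eta>"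
  unfolding ideal_lim_def using assms by (blast intro: ideal_tendsto_unique)

definition ideal_convergent_seqs :: "nat set set \<Rightarrow> (nat \<Rightarrow> real) set" where
  "ideal_convergent_seqs I = {x. \<exists>\<eta>. ideal_tendsto I x \<eta>}"

definition bounded_seqs :: "(nat \<Rightarrow> real) set" where
  "bounded_seqs = {x. bounded (range x)}"

definition mat_well_defined :: "(nat \<Rightarrow> nat \<Rightarrow> real) \<Rightarrow> (nat \<Rightarrow> real) \<Rightarrow> bool" where
  "mat_well_defined A x \<longleftrightarrow> (\<forall>n. summable (\<lambda>k. A n k * x k))"

definition mat_transform :: "(nat \<Rightarrow> nat \<Rightarrow> real) \<Rightarrow> (nat \<Rightarrow> real) \<Rightarrow> (nat \<Rightarrow> real)" where
  "mat_transform A x = (\<lambda>n. \<Sum>k. A n k * x k)"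

definition matrix_class ::
    "(nat \<Rightarrow> real) set \<Rightarrow> (nat \<Rightarrow> real) set \<Rightarrow> (nat \<Rightarrow> nat \<Rightarrow> real) set" where
  "matrix_class X Y = {A. \<forall>x\<in>X. mat_well_defined A x \<and> mat_transform A x \<in> Y}"

definition ideal_regular ::
    "nat set set \<Rightarrow> nat set set \<Rightarrow> (nat \<Rightarrow> nat \<Rightarrow> real) \<Rightarrow> bool" where
  "ideal_regular I J A \<longleftrightarrow>
     A \<in> matrix_class (ideal_convergent_seqs I \<inter> bounded_seqs)
                      (ideal_convergent_seqs J \<inter> bounded_seqs) \<and>
     (\<forall>x \<in> ideal_convergent_seqs I \<inter> bounded_seqs.
        ideal_lim I x = ideal_lim J (mat_transform A x))"

text \<open>
  (T1) is stated with extended nonnegative reals, so that it asserts both that every row is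
  absolutely summable and that the row sums are uniformly bounded. The real-valued sums in (T2) and
  (T3) only have their intended meaning for absolutely summable rows, i.e. in conjunction with (T1).
\<close>

definition T1 :: "(nat \<Rightarrow> nat \<Rightarrow> real) \<Rightarrow> bool" where
  "T1 A \<longleftrightarrow> (SUP n. \<Sum>k. ennreal \<bar>A n k\<bar>) < \<infinity>"

definition T2 :: "nat set set \<Rightarrow> (nat \<Rightarrow> nat \<Rightarrow> real) \<Rightarrow> bool" where
  "T2 J A \<longleftrightarrow> ideal_tendsto J (\<lambda>n. \<Sum>k. A n k) 1"

definition T3 :: "nat set set \<Rightarrow> nat set set \<Rightarrow> (nat \<Rightarrow> nat \<Rightarrow> real) \<Rightarrow> bool" where
  "T3 I J A \<longleftrightarrow> (\<forall>E\<in>I. ideal_tendsto J (\<lambda>n. \<Sum>\<^sub>\<infinity>k\<in>E. \<bar>A n k\<bar>) 0)"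

end

theory Submission
  imports Defs
begin

text \<open>
  Sufficiency: given \<open>\<epsilon> > 0\<close>, split \<open>\<Sum>k. a\<^sub>n\<^sub>k (x\<^sub>k - \<eta>)\<close> along \<open>E = {k. \<bar>x\<^sub>k - \<eta>\<bar> > \<epsilon>} \<in> I\<close>.
  Necessity of (T1): a regular matrix maps null sequences to bounded sequences, and a gliding hump
  argument bounds the row norms. Necessity of (T3): test on sequences supported on \<open>E \<in> I\<close>. The
  indicator of \<open>E\<close> suffices if \<open>A\<close> is nonnegative, finitely many unit vectors suffice if \<open>I = Fin\<close>;
  if \<open>J = Fin\<close>, the columns in \<open>E\<close> form a matrix that maps all bounded sequences to null sequences,
  and Schur's theorem applies.
\<close>

section \<open>Ideal convergence as convergence along the dual filter\<close>

text \<open>The filter dual to \<open>I\<close>: properties that fail only on a set of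
  \<open>I\<close>. It opens the calculus of limits to ideal convergence. \<open>Abs_filter\<close>
  has its intended value only if these properties do form a filter, as they do for admissible
  \<open>I\<close>.\<close>

definition ideal_filter :: "nat set set \<Rightarrow> nat filter" where
  "ideal_filter I = Abs_filter (\<lambda>P. {n. \<not> P n} \<in> I)"

lemma eventually_ideal_filter:
  assumes "admissible_ideal I"
  shows "eventually P (ideal_filter I) \<longleftrightarrow> {n. \<not> P n} \<in> I"
  unfolding ideal_filter_def
proof (rule eventually_Abs_filter, unfold_locales)
  have un: "S \<in> I \<Longrightarrow> T \<in> I \<Longrightarrow> S \<union> T \<in> I"
    and sub: "S \<in> I \<Longrightarrow> T \<subseteq> S \<Longrightarrow> T \<in> I" for S T
    using assms unfolding admissible_ideal_def set_ideal_def by blast+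
  show "{n. \<not> True} \<in> I"
    using assms by (auto simp: admissible_ideal_def Fin_def)
  show "{n. \<not> (P n \<and> Q n)} \<in> I" if "{n. \<not> P n} \<in> I" "{n. \<not> Q n} \<in> I" for P Q
    using un[OF that] by (rule sub) blast
  show "{n. \<not> Q n} \<in> I" if "\<forall>n. P n \<longrightarrow> Q n" "{n. \<not> P n} \<in> I" for P Q
    using that(2) by (rule sub) (use that(1) in blast)
qed

lemma ideal_tendsto_iff_tendsto:
  assumes "admissible_ideal I"
  shows "ideal_tendsto I x \<eta> \<longleftrightarrow> (x \<longlongrightarrow> \<eta>) (ideal_filter I)"
proof
  assume x: "ideal_tendsto I x \<eta>"
  show "(x \<longlongrightarrow> \<eta>) (ideal_filter I)"
  proof (rule tendstoI)
    fix e :: real assume "e > 0"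
    \<comment> \<open>The complement of this set only gives a non-strict bound, so the radius is
      halved to reach the strict one.\<close>
    then have "{n. \<bar>x n - \<eta>\<bar> > e / 2} \<in> I"
      using x unfolding ideal_tendsto_def by (simp only: half_gt_zero)
    then have "\<forall>\<^sub>F n in ideal_filter I. \<bar>x n - \<eta>\<bar> \<le> e / 2"
      by (simp add: eventually_ideal_filter[OF assms] not_le)
    then show "\<forall>\<^sub>F n in ideal_filter I. dist (x n) \<eta> < e"
      by eventually_elim (use \<open>e > 0\<close> in \<open>simp add: dist_real_def\<close>)
  qed
next
  assume x: "(x \<longlongrightarrow> \<eta>) (ideal_filter I)"
  show "ideal_tendsto I x \<eta>"
    unfolding ideal_tendsto_def
  proof (intro allI impI)
    fix e :: real assume "e > 0"
    with x have "\<forall>\<^sub>F n in ideal_filter I. dist (x n) \<eta> < e"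
      by (rule tendstoD)
    then have "\<forall>\<^sub>F n in ideal_filter I. \<bar>x n - \<eta>\<bar> \<le> e"
      by eventually_elim (simp add: dist_real_def)
    then show "{n. \<bar>x n - \<eta>\<bar> > e} \<in> I"
      by (simp add: eventually_ideal_filter[OF assms] not_le)
  qed
qed

text \<open>Follows from \<open>Fin \<subseteq> I\<close>. It turns ordinary limits into
  \<open>I\<close>-limits, so that every null sequence is a legitimate test sequence.\<close>

lemma ideal_filter_le_sequentially:
  assumes "admissible_ideal I"
  shows "ideal_filter I \<le> sequentially"
proof (rule filter_leI)
  fix P assume "eventually P sequentially"
  then have "finite {n. \<not> P n}"
    by (simp add: cofinite_eq_sequentially[symmetric] eventually_cofinite)
  then show "eventually P (ideal_filter I)"
    using assms by (auto simp: eventually_ideal_filter admissible_ideal_def Fin_def)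
qed

lemma ideal_filter_Fin:
  assumes "admissible_ideal Fin"
  shows "ideal_filter Fin = sequentially"
  by (rule filter_eqI, subst eventually_ideal_filter[OF assms])
    (simp add: Fin_def cofinite_eq_sequentially[symmetric] eventually_cofinite)

text \<open>Removes the description operator in \<open>ideal_lim\<close>: by uniqueness of limits,
  the limit of the transform given by membership in \<open>ideal_convergent_seqs J\<close> must be
  \<eta> itself.\<close>

lemma ideal_regular_iff:
  assumes I: "admissible_ideal I" and J: "admissible_ideal J"
  shows "ideal_regular I J A \<longleftrightarrow>
    (\<forall>x \<eta>. (x \<longlongrightarrow> \<eta>) (ideal_filter I) \<longrightarrow> bounded (range x) \<longrightarrow>
      (\<forall>n. summable (\<lambda>k. A n k * x k)) \<and> bounded (range (\<lambda>n. \<Sum>k. A n k * x k)) \<and>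
      ((\<lambda>n. \<Sum>k. A n k * x k) \<longlongrightarrow> \<eta>) (ideal_filter J))" (is "?L \<longleftrightarrow> ?R")
proof
  assume L: ?L
  show ?R
  proof (intro allI impI)
    fix x :: "nat \<Rightarrow> real" and \<eta>
    assume x: "(x \<longlongrightarrow> \<eta>) (ideal_filter I)" and b: "bounded (range x)"
    have xI: "ideal_tendsto I x \<eta>"
      using x by (simp add: ideal_tendsto_iff_tendsto[OF I])
    then have mem: "x \<in> ideal_convergent_seqs I \<inter> bounded_seqs"
      using b by (auto simp: ideal_convergent_seqs_def bounded_seqs_def)
    then obtain \<theta> where wd: "mat_well_defined A x" and bd: "bounded (range (mat_transform A x))"
      and \<theta>: "ideal_tendsto J (mat_transform A x) \<theta>"
      using L by (auto simp: ideal_regular_def matrix_class_def ideal_convergent_seqs_def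
          bounded_seqs_def)
    have "\<eta> = \<theta>"
      using L mem ideal_lim_eqI[OF I xI] ideal_lim_eqI[OF J \<theta>] by (auto simp: ideal_regular_def)
    then show "(\<forall>n. summable (\<lambda>k. A n k * x k)) \<and> bounded (range (\<lambda>n. \<Sum>k. A n k * x k)) \<and>
      ((\<lambda>n. \<Sum>k. A n k * x k) \<longlongrightarrow> \<eta>) (ideal_filter J)"
      using wd bd \<theta> unfolding ideal_tendsto_iff_tendsto[OF J]
      by (simp add: mat_well_defined_def mat_transform_def)
  qed
next
  assume R: ?R
  show ?L
    unfolding ideal_regular_def matrix_class_def mem_Collect_eq ball_conj_distrib[symmetric]
  proof
    fix x assume "x \<in> ideal_convergent_seqs I \<inter> bounded_seqs"
    then obtain \<eta> where xI: "ideal_tendsto I x \<eta>" and b: "bounded (range x)"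
      by (auto simp: ideal_convergent_seqs_def bounded_seqs_def)
    have *: "mat_well_defined A x" "bounded (range (mat_transform A x))"
      "ideal_tendsto J (mat_transform A x) \<eta>"
      using R xI b unfolding ideal_tendsto_iff_tendsto[OF I] ideal_tendsto_iff_tendsto[OF J]
        mat_well_defined_def mat_transform_def by blast+
    then show "(mat_well_defined A x \<and>
        mat_transform A x \<in> ideal_convergent_seqs J \<inter> bounded_seqs) \<and>
        ideal_lim I x = ideal_lim J (mat_transform A x)"
      using ideal_lim_eqI[OF I xI] ideal_lim_eqI[OF J *(3)]
      by (auto simp: ideal_convergent_seqs_def bounded_seqs_def)
  qed
qed

section \<open>Absolutely summable rows and (T1)\<close>

lemma T1_iff:
  "T1 A \<longleftrightarrow> (\<exists>C. \<forall>n. summable (\<lambda>k. \<bar>A n k\<bar>) \<and> (\<Sum>k. \<bar>A n k\<bar>) \<le> C)" (is "_ = ?R")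
proof
  assume T: "T1 A"
  define C where "C = (SUP n. \<Sum>k. ennreal \<bar>A n k\<bar>)"
  have C: "C < top"
    using T by (simp only: T1_def C_def infinity_ennreal_def)
  have le: "(\<Sum>k. ennreal \<bar>A n k\<bar>) \<le> C" for n
    unfolding C_def by (rule SUP_upper) simp
  have "summable (\<lambda>k. \<bar>A n k\<bar>) \<and> (\<Sum>k. \<bar>A n k\<bar>) \<le> enn2real C" for n
  proof -
    \<comment> \<open>Finiteness of the extended series yields real summability, without which the
      real \<open>suminf\<close> could not be compared with \<open>C\<close>.\<close>
    have s: "summable (\<lambda>k. \<bar>A n k\<bar>)"
      using le_less_trans[OF le[of n] C] by (intro summable_suminf_not_top) auto
    then have "ennreal (\<Sum>k. \<bar>A n k\<bar>) \<le> C"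
      using le[of n] by (simp add: suminf_ennreal2)
    then show ?thesis
      using s C enn2real_mono[of "ennreal (\<Sum>k. \<bar>A n k\<bar>)" C]
      by (simp add: suminf_nonneg)
  qed
  then show ?R by blast
next
  assume ?R
  then obtain C where s: "\<And>n. summable (\<lambda>k. \<bar>A n k\<bar>)" and C: "\<And>n. (\<Sum>k. \<bar>A n k\<bar>) \<le> C"
    by blast
  have "(SUP n. \<Sum>k. ennreal \<bar>A n k\<bar>) \<le> ennreal C"
    by (rule SUP_least) (simp add: suminf_ennreal2 s C ennreal_leI)
  also have "\<dots> < \<infinity>" by simp
  finally show "T1 A" unfolding T1_def .
qed

lemma summable_abs_mult_bounded:
  fixes f x :: "nat \<Rightarrow> real"
  assumes "summable (\<lambda>k. \<bar>f k\<bar>)" and "\<And>k. \<bar>x k\<bar> \<le> M"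
  shows "summable (\<lambda>k. \<bar>f k * x k\<bar>)"
proof (rule summable_comparison_test')
  show "summable (\<lambda>k. \<bar>f k\<bar> * M)"
    using assms(1) by (rule summable_mult2)
  show "norm \<bar>f k * x k\<bar> \<le> \<bar>f k\<bar> * M" if "k \<ge> 0" for k
    using assms(2) by (simp add: abs_mult mult_left_mono)
qed

lemma abs_suminf_mult_le:
  fixes f x :: "nat \<Rightarrow> real"
  assumes f: "summable (\<lambda>k. \<bar>f k\<bar>)" and x: "\<And>k. \<bar>x k\<bar> \<le> M"
  shows "\<bar>\<Sum>k. f k * x k\<bar> \<le> (\<Sum>k. \<bar>f k\<bar>) * M"
proof -
  have s: "summable (\<lambda>k. \<bar>f k * x k\<bar>)"
    using assms by (rule summable_abs_mult_bounded)
  have "\<bar>\<Sum>k. f k * x k\<bar> \<le> (\<Sum>k. \<bar>f k * x k\<bar>)"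
    using s by (rule summable_rabs)
  also have "\<dots> \<le> (\<Sum>k. \<bar>f k\<bar> * M)"
    using x by (intro suminf_le s summable_mult2 f) (simp add: abs_mult mult_left_mono)
  also have "\<dots> = (\<Sum>k. \<bar>f k\<bar>) * M"
    using f by (rule suminf_mult2[symmetric])
  finally show ?thesis .
qed

text \<open>Absolute summability makes the unordered sum agree with the series. The sums in (T3)
  thereby become transforms of an indicator.\<close>

lemma infsum_abs_eq_suminf_indicator:
  fixes f :: "nat \<Rightarrow> real"
  assumes "summable (\<lambda>k. \<bar>f k\<bar>)"
  shows "(\<Sum>\<^sub>\<infinity>k\<in>E. \<bar>f k\<bar>) = (\<Sum>k. \<bar>f k\<bar> * indicator E k)"
proof -
  have "summable (\<lambda>k. norm (\<bar>f k\<bar> * indicator E k))"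
    unfolding real_norm_def
    by (rule summable_abs_mult_bounded[where M = 1]) (use assms in \<open>auto split: split_indicator\<close>)
  from norm_summable_imp_has_sum[OF this summable_sums[OF summable_norm_cancel[OF this]]]
  have "((\<lambda>k. \<bar>f k\<bar> * indicator E k) has_sum (\<Sum>k. \<bar>f k\<bar> * indicator E k)) UNIV" .
  then have "(\<Sum>\<^sub>\<infinity>k. \<bar>f k\<bar> * indicator E k) = (\<Sum>k. \<bar>f k\<bar> * indicator E k)"
    by (rule infsumI)
  moreover have "(\<Sum>\<^sub>\<infinity>k\<in>E. \<bar>f k\<bar>) = (\<Sum>\<^sub>\<infinity>k. \<bar>f k\<bar> * indicator E k)"
    by (rule infsum_cong_neutral) (auto split: split_indicator)
  ultimately show ?thesis by simp
qed

section \<open>Gliding hump, bounded row norms, Schur's theorem\<close>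

text \<open>
  The vector \<open>x\<close> is built from consecutive finite blocks: on the \<open>j\<close>-th one, which carries almost all
  of the mass of the row \<open>n j\<close>, it is \<open>w j\<close> times the sign of that row. Constant weights yield
  Schur's theorem; weights tending to zero yield a null sequence \<open>x\<close>.
\<close>

lemma gliding_hump:
  fixes b :: "nat \<Rightarrow> nat \<Rightarrow> real" and w :: "nat \<Rightarrow> real"
  assumes rows: "\<And>n. summable (\<lambda>k. \<bar>b n k\<bar>)"
    and cols: "\<And>k. (\<lambda>n. b n k) \<longlonglongrightarrow> 0"
    and norms: "\<And>n. \<delta> \<le> (\<Sum>k. \<bar>b n k\<bar>)" and "\<delta> > 0"
    and w: "\<And>j. w j > 0" "\<And>j. w j \<le> 1"
  obtains n :: "nat \<Rightarrow> nat" and x :: "nat \<Rightarrow> real"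
  where "strict_mono n" "\<And>k. \<bar>x k\<bar> \<le> 1" "w \<longlonglongrightarrow> 0 \<Longrightarrow> x \<longlonglongrightarrow> 0"
    "\<And>j. w j * \<delta> / 2 \<le> (\<Sum>k. b (n j) k * x k)"
proof -
  \<comment> \<open>Four errors of size at most \<open>e j\<close> occur: two from the mass of the
    row outside its block, scaled by \<open>w j \<le> 1\<close>, and one each from the values of the
    head and of the tail. Together they cost at most half of \<open>w j * \<delta>\<close>.\<close>
  define e where "e j = w j * \<delta> / 8" for j
  have e: "e j > 0" for j
    using w \<open>\<delta> > 0\<close> by (simp add: e_def)
  \<comment> \<open>A state is a pair (row, right end of the block). Null columns give a later row
    that is small on everything already used; summability of that row then gives the next end. The
    row component of the initial state \<open>(0, 0)\<close> is only a starting bound.\<close>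
  have "\<exists>s :: nat \<Rightarrow> nat \<times> nat. \<forall>j. (j = 0 \<longrightarrow> snd (s j) = 0) \<and>
      (fst (s j) < fst (s (Suc j)) \<and> snd (s j) < snd (s (Suc j)) \<and>
      (\<Sum>k<snd (s j). \<bar>b (fst (s (Suc j))) k\<bar>) \<le> e j \<and>
      (\<Sum>k. \<bar>b (fst (s (Suc j))) (k + snd (s (Suc j)))\<bar>) \<le> e j)"
  proof (rule dependent_nat_choice, goal_cases)
    case 1
    show ?case by (intro exI[of _ "(0, 0)"]) simp
  next
    case (2 p j)
    have "(\<lambda>n. \<Sum>k<snd p. \<bar>b n k\<bar>) \<longlonglongrightarrow> (\<Sum>k<snd p. \<bar>0 :: real\<bar>)"
      by (intro tendsto_intros cols)
    then have "\<forall>\<^sub>F n in sequentially. (\<Sum>k<snd p. \<bar>b n k\<bar>) < e j"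
      using e[of j] by (intro order_tendstoD(2)) auto
    then have "\<forall>\<^sub>F n in sequentially. fst p < n \<and> (\<Sum>k<snd p. \<bar>b n k\<bar>) < e j"
      using eventually_gt_at_top by (rule eventually_conj[rotated])
    then obtain n where n: "fst p < n" "(\<Sum>k<snd p. \<bar>b n k\<bar>) < e j"
      using eventually_happens'[OF sequentially_bot] by blast
    obtain M where M: "\<And>m. m \<ge> M \<Longrightarrow> norm (\<Sum>k. \<bar>b n (k + m)\<bar>) < e j"
      using suminf_exist_split[OF e rows] by blast
    \<comment> \<open>The maximum with \<open>Suc (snd p)\<close> keeps the block ends strictly
      increasing.\<close>
    show ?case
      using n M[of "max M (Suc (snd p))"]
      by (intro exI[of _ "(n, max M (Suc (snd p)))"]) auto
  qed
  then obtain s :: "nat \<Rightarrow> nat \<times> nat" where s0: "snd (s 0) = 0" and s: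
    "\<And>j. fst (s j) < fst (s (Suc j))" "\<And>j. snd (s j) < snd (s (Suc j))"
    "\<And>j. (\<Sum>k<snd (s j). \<bar>b (fst (s (Suc j))) k\<bar>) \<le> e j"
    "\<And>j. (\<Sum>k. \<bar>b (fst (s (Suc j))) (k + snd (s (Suc j)))\<bar>) \<le> e j"
    by metis
  \<comment> \<open>Index shift: block \<open>j\<close> runs from \<open>N j\<close> up to but
    excluding \<open>N (Suc j)\<close>, and its row was chosen together with its right end, hence in
    state \<open>Suc j\<close>.\<close>
  define n where "n j = fst (s (Suc j))" for j
  define N where "N j = snd (s j)" for j
  have n: "strict_mono n"
    using s(1) by (simp add: n_def strict_mono_Suc_iff)
  have N: "strict_mono N" and N0: "N 0 = 0"
    using s(2) s0 by (simp_all add: N_def strict_mono_Suc_iff)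
  have head: "(\<Sum>k<N j. \<bar>b (n j) k\<bar>) \<le> e j"
    and tail: "(\<Sum>k. \<bar>b (n j) (k + N (Suc j))\<bar>) \<le> e j" for j
    using s(3,4) by (simp_all add: n_def N_def)
  \<comment> \<open>The index of the block containing \<open>k\<close>; it exists because
    \<open>N\<close> is strictly increasing from 0.\<close>
  define blk where "blk k = (LEAST j. k < N (Suc j))" for k
  define x where "x k = w (blk k) * sgn (b (n (blk k)) k)" for k
  have ex: "k < N (Suc k)" for k
    using strict_mono_imp_increasing[OF N, of "Suc k"] by simp
  have blk_eq: "blk k = j" if "N j \<le> k" "k < N (Suc j)" for j k
    unfolding blk_def
  proof (rule Least_equality)
    fix i assume "k < N (Suc i)"
    with that(1) have "N j < N (Suc i)" by simp
    then show "j \<le> i" using N by (simp add: strict_mono_less)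
  qed (fact that(2))
  have blk_ge: "j \<le> blk k" if "N j \<le> k" for j k
  proof -
    have "k < N (Suc (blk k))"
      unfolding blk_def using ex by (rule LeastI)
    with that have "N j < N (Suc (blk k))" by simp
    then show ?thesis using N by (simp add: strict_mono_less)
  qed
  have x_le: "\<bar>x k\<bar> \<le> w (blk k)" for k
    using w(1)[of "blk k"] by (simp add: x_def abs_mult sgn_if)
  have x1: "\<bar>x k\<bar> \<le> 1" for k
    using x_le[of k] w(2)[of "blk k"] by simp
  have x0: "x \<longlonglongrightarrow> 0" if "w \<longlonglongrightarrow> 0"
  proof -
    have "filterlim blk at_top sequentially"
      unfolding filterlim_at_top eventually_sequentially using blk_ge by blast
    with that have "(\<lambda>k. w (blk k)) \<longlonglongrightarrow> 0"
      by (rule filterlim_compose)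
    then show ?thesis
      by (rule Lim_null_comparison[rotated]) (simp add: x_le)
  qed
  have "w j * \<delta> / 2 \<le> (\<Sum>k. b (n j) k * x k)" for j
  proof -
    let ?b = "b (n j)"
    let ?l = "N j" and ?u = "N (Suc j)"
    have lu: "?l \<le> ?u" using s(2)[of j] by (simp add: N_def)
    have split: "sum f {..<?u} = sum f {..<?l} + sum f {?l..<?u}" for f :: "nat \<Rightarrow> real"
      using sum.atLeastLessThan_concat[of 0 ?l ?u f] lu by (simp add: atLeast0LessThan)
    have abs_bx: "summable (\<lambda>k. \<bar>?b k * x k\<bar>)"
      using rows x1 by (rule summable_abs_mult_bounded)
    have "\<delta> \<le> (\<Sum>k. \<bar>?b k\<bar>)" by (rule norms)
    also have "\<dots> = (\<Sum>k. \<bar>?b (k + ?u)\<bar>) + (\<Sum>k<?u. \<bar>?b k\<bar>)"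
      using rows by (rule suminf_split_initial_segment)
    \<comment> \<open>Head and tail take at most \<open>e j\<close> each, so the rest of the row
      norm lies in the block.\<close>
    finally have block: "\<delta> - 2 * e j \<le> (\<Sum>k=?l..<?u. \<bar>?b k\<bar>)"
      using head[of j] tail[of j] by (simp add: split)
    have "\<bar>\<Sum>k<?l. ?b k * x k\<bar> \<le> (\<Sum>k<?l. \<bar>?b k * x k\<bar>)" by (rule sum_abs)
    also have "\<dots> \<le> (\<Sum>k<?l. \<bar>?b k\<bar>)"
      using x1 by (intro sum_mono) (simp add: abs_mult mult_left_le)
    finally have 1: "\<bar>\<Sum>k<?l. ?b k * x k\<bar> \<le> e j" using head[of j] by simp
    have "\<bar>\<Sum>k. ?b (k + ?u) * x (k + ?u)\<bar> \<le> (\<Sum>k. \<bar>?b (k + ?u)\<bar>) * 1"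
      by (intro abs_suminf_mult_le summable_ignore_initial_segment rows x1)
    then have 2: "\<bar>\<Sum>k. ?b (k + ?u) * x (k + ?u)\<bar> \<le> e j" using tail[of j] by simp
    have "(\<Sum>k=?l..<?u. ?b k * x k) = (\<Sum>k=?l..<?u. w j * \<bar>?b k\<bar>)"
      by (rule sum.cong) (auto simp: x_def blk_eq sgn_if)
    then have 3: "(\<Sum>k=?l..<?u. ?b k * x k) = w j * (\<Sum>k=?l..<?u. \<bar>?b k\<bar>)"
      by (simp add: sum_distrib_left)
    have "w j * (\<delta> - 2 * e j) \<le> w j * (\<Sum>k=?l..<?u. \<bar>?b k\<bar>)"
      using block w(1)[of j] by (intro mult_left_mono) auto
    moreover have "w j * (2 * e j) \<le> 2 * e j"
      using w(2)[of j] e[of j] by (simp add: mult_left_le_one_le w less_imp_le)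
    moreover have "(\<Sum>k. ?b k * x k) =
        (\<Sum>k. ?b (k + ?u) * x (k + ?u)) + (\<Sum>k<?u. ?b k * x k)"
      by (rule suminf_split_initial_segment) (rule summable_rabs_cancel[OF abs_bx])
    moreover have "w j * \<delta> = 8 * e j" by (simp add: e_def)
    ultimately show ?thesis
      using 1 2 3 unfolding split right_diff_distrib by linarith
  qed
  with n x1 x0 that show thesis by blast
qed

lemma unbounded_if_ge_exp:
  fixes f :: "nat \<Rightarrow> real"
  assumes "\<And>j. 2 ^ j \<le> f (g j)"
  shows "\<not> bounded (range f)"
proof
  assume "bounded (range f)"
  then obtain B where B: "\<And>n. \<bar>f n\<bar> \<le> B" by (auto simp: bounded_iff)
  obtain j where "B < 2 ^ j" using real_arch_pow[of 2 B] by auto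
  with assms[of j] B[of "g j"] show False by linarith
qed

text \<open>If the norms were unbounded, rows with rapidly growing norms could be normalised. Unit
  vectors show that the columns of \<open>A\<close> are bounded, so the normalised columns tend to
  0. The gliding hump with weights \<open>(1/2) ^ j\<close> then produces a null sequence with
  unbounded transform.\<close>

lemma row_sums_bounded:
  fixes A :: "nat \<Rightarrow> nat \<Rightarrow> real"
  assumes rows: "\<And>n. summable (\<lambda>k. \<bar>A n k\<bar>)"
    and bdd: "\<And>x. x \<longlonglongrightarrow> 0 \<Longrightarrow> bounded (range (\<lambda>n. \<Sum>k. A n k * x k))"
  shows "\<exists>C. \<forall>n. (\<Sum>k. \<bar>A n k\<bar>) \<le> C"
proof (rule ccontr)
  assume "\<not> ?thesis"
  \<comment> \<open>The factor 2 offsets the loss of one half in the gliding hump;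
    \<open>4 ^ j\<close> outweighs the weight \<open>(1/2) ^ j\<close> and leaves
    \<open>2 ^ j\<close>.\<close>
  then have "\<forall>j. \<exists>n. 2 * 4 ^ j < (\<Sum>k. \<bar>A n k\<bar>)"
    by (meson not_le)
  then obtain m where m: "\<And>j :: nat. 2 * 4 ^ j < (\<Sum>k. \<bar>A (m j) k\<bar>)"
    by metis
  define c where "c j = (\<Sum>k. \<bar>A (m j) k\<bar>)" for j
  have c: "2 * 4 ^ j < c j" for j using m by (simp add: c_def)
  have cpos: "c j > 0" for j using c[of j] zero_less_power[of "4::real" j] by linarith
  define b where "b j k = A (m j) k / c j" for j k
  have abs_b: "\<bar>b j k\<bar> = \<bar>A (m j) k\<bar> / c j" for j k
    using cpos[of j] by (simp add: b_def)
  have cols: "(\<lambda>j. b j k) \<longlonglongrightarrow> 0" for k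
  proof -
    have "(indicator {k} :: nat \<Rightarrow> real) \<longlonglongrightarrow> 0"
      by (rule tendsto_eventually) (auto simp: eventually_sequentially intro!: exI[of _ "Suc k"])
    then have "bounded (range (\<lambda>n. \<Sum>i. A n i * indicator {k} i))" by (rule bdd)
    moreover have "(\<Sum>i. A n i * indicator {k} i) = A n k" for n
      by (subst suminf_finite[of "{k}"]) auto
    ultimately obtain B where B: "\<And>n. \<bar>A n k\<bar> \<le> B" by (auto simp: bounded_iff)
    have "norm (b j k) \<le> B * (1/4) ^ j" for j
    proof -
      have "norm (b j k) \<le> B / c j"
        using B cpos[of j] by (simp add: abs_b divide_right_mono)
      also have "\<dots> \<le> B / 4 ^ j"
        using B[of 0] c[of j] cpos[of j] zero_less_power[of "4::real" j]
        by (intro divide_left_mono) auto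
      finally show ?thesis by (simp add: power_one_over)
    qed
    moreover have "(\<lambda>j. B * (1/4) ^ j) \<longlonglongrightarrow> 0"
      by (intro tendsto_mult_right_zero LIMSEQ_realpow_zero) auto
    ultimately show ?thesis by (rule Lim_null_comparison[OF always_eventually[OF allI]])
  qed
  have sb: "summable (\<lambda>k. \<bar>b j k\<bar>)" for j
    unfolding abs_b by (intro summable_divide rows)
  have nb: "1 \<le> (\<Sum>k. \<bar>b j k\<bar>)" for j
    unfolding abs_b suminf_divide[OF rows] using cpos[of j] by (simp add: c_def)
  obtain n :: "nat \<Rightarrow> nat" and x :: "nat \<Rightarrow> real" where n: "strict_mono n"
    and x1: "\<And>k. \<bar>x k\<bar> \<le> 1"
    and x0: "(\<lambda>j. (1/2) ^ j :: real) \<longlonglongrightarrow> 0 \<Longrightarrow> x \<longlonglongrightarrow> 0"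
    and x: "\<And>j. (1/2) ^ j * 1 / 2 \<le> (\<Sum>k. b (n j) k * x k)"
    by (rule gliding_hump[OF sb cols nb, of "\<lambda>j. (1/2) ^ j"]) (auto simp: power_le_one)
  have "x \<longlonglongrightarrow> 0" by (intro x0 LIMSEQ_realpow_zero) auto
  then have "bounded (range (\<lambda>n. \<Sum>k. A n k * x k))" by (rule bdd)
  moreover have "2 ^ j \<le> (\<Sum>k. A (m (n j)) k * x k)" for j
  proof -
    have sAx: "summable (\<lambda>k. A (m (n j)) k * x k)"
      using rows x1 by (rule summable_rabs_cancel[OF summable_abs_mult_bounded])
    \<comment> \<open>A strictly increasing \<open>n\<close> satisfies \<open>j \<le> n j\<close>,
      so the growth survives the passage to the selected rows.\<close>
    have "(4::real) ^ j \<le> 4 ^ n j"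
      using strict_mono_imp_increasing[OF n, of j] by (intro power_increasing) auto
    then have "2 * 4 ^ j \<le> c (n j)"
      using c[of "n j"] by linarith
    then have "2 * 4 ^ j * ((1/2) ^ j / 2) \<le> c (n j) * ((1/2) ^ j / 2)"
      by (rule mult_right_mono) simp
    moreover have "2 * 4 ^ j * ((1/2) ^ j / 2) = (2::real) ^ j"
      using power_mult_distrib[of 4 "1/2 :: real" j] by simp
    moreover have "c (n j) * ((1/2) ^ j / 2) \<le> c (n j) * (\<Sum>k. b (n j) k * x k)"
      using x[of j] cpos[of "n j"] by (intro mult_left_mono) auto
    moreover have "c (n j) * (\<Sum>k. b (n j) k * x k) = (\<Sum>k. A (m (n j)) k * x k)"
      using suminf_divide[OF sAx, of "c (n j)"] cpos[of "n j"] by (simp add: b_def)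
    ultimately show ?thesis by linarith
  qed
  then have "\<not> bounded (range (\<lambda>n. \<Sum>k. A n k * x k))"
    by (rule unbounded_if_ge_exp[where g = "\<lambda>j. m (n j)"])
  ultimately show False by blast
qed

text \<open>The partial sums of \<open>\<Sum>k. a k * x k\<close> are the transform of \<open>x\<close> by the truncations of \<open>a\<close>.\<close>

lemma summable_abs_if_summable_mult_null:
  fixes a :: "nat \<Rightarrow> real"
  assumes "\<And>x. x \<longlonglongrightarrow> 0 \<Longrightarrow> summable (\<lambda>k. a k * x k)"
  shows "summable (\<lambda>k. \<bar>a k\<bar>)"
proof -
  define t where "t n k = (if k < n then a k else 0)" for n k
  have tsum: "(\<Sum>k. t n k * x k) = (\<Sum>k<n. a k * x k)" for n x
    by (subst suminf_finite[of "{..<n}"]) (auto simp: t_def)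
  have tabs: "(\<Sum>k. \<bar>t n k\<bar>) = (\<Sum>k<n. \<bar>a k\<bar>)" for n
    by (subst suminf_finite[of "{..<n}"]) (auto simp: t_def)
  have "\<exists>C. \<forall>n. (\<Sum>k. \<bar>t n k\<bar>) \<le> C"
  proof (rule row_sums_bounded)
    show "summable (\<lambda>k. \<bar>t n k\<bar>)" for n
      by (rule summable_finite[of "{..<n}"]) (auto simp: t_def)
    show "bounded (range (\<lambda>n. \<Sum>k. t n k * x k))" if "x \<longlonglongrightarrow> 0" for x
      unfolding tsum using summable_imp_sums_bounded[OF assms[OF that]] .
  qed
  then obtain C where "\<And>n. (\<Sum>k<n. \<bar>a k\<bar>) \<le> C" unfolding tabs by blast
  from this[of "Suc _"] show ?thesis
    unfolding lessThan_Suc_atMost by (rule bounded_imp_summable[rotated]) simp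
qed

text \<open>Otherwise infinitely many rows have norm at least some \<open>\<delta> > 0\<close>, and
  unit vectors show that the columns tend to 0. The gliding hump with constant weight 1 gives a
  bounded \<open>x\<close> whose transform stays at least \<open>\<delta> / 2\<close> along a
  subsequence.\<close>

lemma schur:
  fixes A :: "nat \<Rightarrow> nat \<Rightarrow> real"
  assumes rows: "\<And>n. summable (\<lambda>k. \<bar>A n k\<bar>)"
    and null: "\<And>x. (\<And>k. \<bar>x k\<bar> \<le> 1) \<Longrightarrow> (\<lambda>n. \<Sum>k. A n k * x k) \<longlonglongrightarrow> 0"
  shows "(\<lambda>n. \<Sum>k. \<bar>A n k\<bar>) \<longlonglongrightarrow> 0"
proof (rule ccontr)
  assume "\<not> ?thesis"
  then obtain \<delta> where "\<delta> > 0" and "\<not> (\<forall>\<^sub>F n in sequentially. dist (\<Sum>k. \<bar>A n k\<bar>) 0 < \<delta>)"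
    unfolding tendsto_iff by blast
  then have "\<exists>\<^sub>F n in cofinite. \<delta> \<le> (\<Sum>k. \<bar>A n k\<bar>)"
    by (simp add: cofinite_eq_sequentially not_eventually dist_real_def not_less suminf_nonneg rows)
  then have "infinite {n. \<delta> \<le> (\<Sum>k. \<bar>A n k\<bar>)}"
    by (simp add: frequently_cofinite)
  from infinite_enumerate[OF this] obtain r :: "nat \<Rightarrow> nat"
    where r: "strict_mono r" "\<And>j. \<delta> \<le> (\<Sum>k. \<bar>A (r j) k\<bar>)"
    by auto
  have cols: "(\<lambda>j. A (r j) k) \<longlonglongrightarrow> 0" for k
  proof -
    have "(\<lambda>n. \<Sum>i. A n i * indicator {k} i) \<longlonglongrightarrow> 0"
      by (rule null) (simp split: split_indicator)
    moreover have "(\<Sum>i. A n i * indicator {k} i) = A n k" for n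
      by (subst suminf_finite[of "{k}"]) auto
    ultimately have "(\<lambda>n. A n k) \<longlonglongrightarrow> 0" by simp
    from LIMSEQ_subseq_LIMSEQ[OF this r(1)] show ?thesis by (simp add: o_def)
  qed
  obtain n :: "nat \<Rightarrow> nat" and x :: "nat \<Rightarrow> real" where n: "strict_mono n"
    and x1: "\<And>k. \<bar>x k\<bar> \<le> 1"
    and x: "\<And>j. 1 * \<delta> / 2 \<le> (\<Sum>k. A (r (n j)) k * x k)"
    by (rule gliding_hump[OF rows cols r(2) \<open>\<delta> > 0\<close>, of "\<lambda>j. 1"]) auto
  have "(\<lambda>j. \<Sum>k. A (r (n j)) k * x k) \<longlonglongrightarrow> 0"
    using LIMSEQ_subseq_LIMSEQ[OF null[OF x1] strict_mono_o[OF r(1) n]] by (simp add: o_def)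
  then have "1 * \<delta> / 2 \<le> 0"
    by (rule LIMSEQ_le_const) (use x in blast)
  with \<open>\<delta> > 0\<close> show False by simp
qed

section \<open>Sufficiency of (T1)-(T3) and the equivalence\<close>

text \<open>Supplies the test sequences for (T3), which need not be null in the ordinary
  sense.\<close>

lemma tendsto_zero_ideal_filter_if_supported:
  assumes "admissible_ideal I" and "E \<in> I" and "\<And>k. k \<notin> E \<Longrightarrow> x k = 0"
  shows "(x \<longlongrightarrow> (0::real)) (ideal_filter I)"
proof (rule tendsto_eventually)
  have "{n. x n \<noteq> 0} \<subseteq> E" using assms(3) by blast
  then show "\<forall>\<^sub>F n in ideal_filter I. x n = 0"
    using assms(1,2) unfolding eventually_ideal_filter[OF assms(1)] admissible_ideal_def set_ideal_def
    by blast
qed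

text \<open>After recentring at \<eta>, the part on the exceptional set is a bounded factor times a
  mass that vanishes by (T3), the other part is a small factor times a row norm bounded by (T1), and
  (T2) restores \<eta>.\<close>

lemma regular_if_T1_T2_T3:
  assumes I: "admissible_ideal I" and J: "admissible_ideal J"
    and "T1 A" "T2 J A" "T3 I J A"
  shows "ideal_regular I J A"
  unfolding ideal_regular_iff[OF I J]
proof (intro allI impI conjI)
  fix x :: "nat \<Rightarrow> real" and \<eta>
  assume x: "(x \<longlongrightarrow> \<eta>) (ideal_filter I)" and "bounded (range x)"
  obtain C where rows: "\<And>n. summable (\<lambda>k. \<bar>A n k\<bar>)" and C: "\<And>n. (\<Sum>k. \<bar>A n k\<bar>) \<le> C"
    using \<open>T1 A\<close> unfolding T1_iff by blast
  obtain M where M: "\<And>k. \<bar>x k\<bar> \<le> M"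
    using \<open>bounded (range x)\<close> by (auto simp: bounded_iff)
  have "M \<ge> 0" using M[of 0] by linarith
  have "C \<ge> 0" using C[of 0] suminf_nonneg[OF rows[of 0]] by simp
  show sAx: "summable (\<lambda>k. A n k * x k)" for n
    using rows M by (rule summable_rabs_cancel[OF summable_abs_mult_bounded])
  have "\<bar>\<Sum>k. A n k * x k\<bar> \<le> C * M" for n
    using abs_suminf_mult_le[of "A n" x, OF rows M] mult_right_mono[OF C[of n] \<open>M \<ge> 0\<close>] by linarith
  then show "bounded (range (\<lambda>n. \<Sum>k. A n k * x k))"
    unfolding bounded_iff by (intro exI[of _ "C * M"]) auto
  have sA: "summable (A n)" for n
    using rows by (rule summable_rabs_cancel)
  have T2: "((\<lambda>n. \<Sum>k. A n k) \<longlongrightarrow> 1) (ideal_filter J)"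
    using \<open>T2 J A\<close> by (simp add: T2_def ideal_tendsto_iff_tendsto[OF J])
  have "((\<lambda>n. \<Sum>k. A n k * (x k - \<eta>)) \<longlongrightarrow> 0) (ideal_filter J)"
  proof (rule tendstoI)
    fix e :: real assume "e > 0"
    \<comment> \<open>Chosen so that \<open>C * d \<le> e / 2\<close>; adding 1 avoids division by
      zero when \<open>C = 0\<close>.\<close>
    define d where "d = e / (2 * (C + 1))"
    have "d > 0" using \<open>e > 0\<close> \<open>C \<ge> 0\<close> by (simp add: d_def)
    have Cd: "C * d \<le> e / 2"
      using \<open>e > 0\<close> \<open>C \<ge> 0\<close> by (simp add: d_def field_simps)
    define E where "E = {k. \<bar>x k - \<eta>\<bar> > d}"
    have "E \<in> I"
      using x \<open>d > 0\<close> unfolding ideal_tendsto_iff_tendsto[OF I, symmetric] ideal_tendsto_def E_def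
      by blast
    then have "((\<lambda>n. \<Sum>k. \<bar>A n k\<bar> * indicator E k) \<longlongrightarrow> 0) (ideal_filter J)"
      using \<open>T3 I J A\<close> unfolding T3_def ideal_tendsto_iff_tendsto[OF J]
        infsum_abs_eq_suminf_indicator[OF rows] by blast
    then have "((\<lambda>n. (\<Sum>k. \<bar>A n k\<bar> * indicator E k) * (M + \<bar>\<eta>\<bar>)) \<longlongrightarrow> 0) (ideal_filter J)"
      by (rule tendsto_mult_left_zero)
    then have "\<forall>\<^sub>F n in ideal_filter J. (\<Sum>k. \<bar>A n k\<bar> * indicator E k) * (M + \<bar>\<eta>\<bar>) < e / 2"
      using \<open>e > 0\<close> by (intro order_tendstoD(2)) auto
    then show "\<forall>\<^sub>F n in ideal_filter J. dist (\<Sum>k. A n k * (x k - \<eta>)) 0 < e"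
    proof eventually_elim
      case (elim n)
      have bd: "\<bar>x k - \<eta>\<bar> \<le> M + \<bar>\<eta>\<bar>" for k using M[of k] by linarith
      have s: "summable (\<lambda>k. \<bar>A n k * (x k - \<eta>)\<bar>)"
        using rows bd by (rule summable_abs_mult_bounded)
      have sE: "summable (\<lambda>k. \<bar>A n k\<bar> * indicator E k)"
        by (rule summable_rabs_cancel[OF summable_abs_mult_bounded[where M = 1]])
          (use rows in \<open>auto split: split_indicator\<close>)
      have "\<bar>\<Sum>k. A n k * (x k - \<eta>)\<bar> \<le> (\<Sum>k. \<bar>A n k * (x k - \<eta>)\<bar>)"
        using s by (rule summable_rabs)
      \<comment> \<open>On \<open>E\<close> the first summand alone dominates, off \<open>E\<close>
        the second.\<close>
      also have "\<dots> \<le> (\<Sum>k. \<bar>A n k\<bar> * indicator E k * (M + \<bar>\<eta>\<bar>) + \<bar>A n k\<bar> * d)"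
      proof (intro suminf_le s summable_add summable_mult2 sE rows)
        fix k
        show "\<bar>A n k * (x k - \<eta>)\<bar> \<le> \<bar>A n k\<bar> * indicator E k * (M + \<bar>\<eta>\<bar>) + \<bar>A n k\<bar> * d"
        proof (cases "k \<in> E")
          case True
          then show ?thesis
            using mult_left_mono[OF bd[of k], of "\<bar>A n k\<bar>"] \<open>d > 0\<close>
            by (simp add: abs_mult add_increasing2)
        next
          case False
          then show ?thesis
            by (simp add: abs_mult E_def mult_left_mono)
        qed
      qed
      also have "\<dots> = (\<Sum>k. \<bar>A n k\<bar> * indicator E k) * (M + \<bar>\<eta>\<bar>) + (\<Sum>k. \<bar>A n k\<bar>) * d"
        using suminf_add[OF summable_mult2[OF sE] summable_mult2[OF rows]]
          suminf_mult2[OF sE] suminf_mult2[OF rows] by simp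
      also have "\<dots> < e / 2 + e / 2"
        using elim mult_right_mono[OF C[of n], of d] \<open>d > 0\<close> Cd by linarith
      finally show ?case by (simp add: dist_real_def)
    qed
  qed
  \<comment> \<open>Undo the recentring: the row sums times \<eta> tend to \<eta> by (T2).\<close>
  then have "((\<lambda>n. (\<Sum>k. A n k * (x k - \<eta>)) + (\<Sum>k. A n k) * \<eta>) \<longlongrightarrow> 0 + 1 * \<eta>) (ideal_filter J)"
    by (intro tendsto_intros T2)
  moreover have "(\<Sum>k. A n k * (x k - \<eta>)) + (\<Sum>k. A n k) * \<eta> = (\<Sum>k. A n k * x k)" for n
    using suminf_diff[OF sAx summable_mult2[OF sA], of n n \<eta>] suminf_mult2[OF sA, of n \<eta>]
    by (simp add: right_diff_distrib)
  ultimately show "((\<lambda>n. \<Sum>k. A n k * x k) \<longlongrightarrow> \<eta>) (ideal_filter J)"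
    by simp
qed

theorem theorem1p3:
  fixes I J :: "nat set set" and A :: "nat \<Rightarrow> nat \<Rightarrow> real"
  assumes "admissible_ideal I" and "admissible_ideal J"
    and "(\<forall>n k. A n k \<ge> 0) \<or> I = Fin \<or> J = Fin"
  shows "ideal_regular I J A \<longleftrightarrow> T1 A \<and> T2 J A \<and> T3 I J A"
proof
  note I = assms(1) and J = assms(2)
  assume "ideal_regular I J A"
  then have reg: "\<And>n. summable (\<lambda>k. A n k * x k)" "bounded (range (\<lambda>n. \<Sum>k. A n k * x k))"
      "((\<lambda>n. \<Sum>k. A n k * x k) \<longlongrightarrow> \<eta>) (ideal_filter J)"
    if "(x \<longlongrightarrow> \<eta>) (ideal_filter I)" "bounded (range x)" for x \<eta>
    using that unfolding ideal_regular_iff[OF I J] by blast+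
  \<comment> \<open>Both tests leading to (T1), for summable rows and for bounded norms, use null
    sequences only.\<close>
  have c0: "(x \<longlongrightarrow> 0) (ideal_filter I)" "bounded (range x)"
    if "x \<longlonglongrightarrow> 0" for x :: "nat \<Rightarrow> real"
    using that tendsto_mono[OF ideal_filter_le_sequentially[OF I]] convergent_imp_bounded by blast+
  have rows: "summable (\<lambda>k. \<bar>A n k\<bar>)" for n
    by (rule summable_abs_if_summable_mult_null) (rule reg(1)[OF c0])
  have "\<exists>C. \<forall>n. (\<Sum>k. \<bar>A n k\<bar>) \<le> C"
    by (rule row_sums_bounded[OF rows]) (rule reg(2)[OF c0])
  with rows have "T1 A" by (simp add: T1_iff)
  moreover have "T2 J A"
    using reg(3)[of "\<lambda>_. 1" 1] by (simp add: T2_def ideal_tendsto_iff_tendsto[OF J])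
  moreover have "T3 I J A"
    unfolding T3_def ideal_tendsto_iff_tendsto[OF J]
  proof
    fix E assume "E \<in> I"
    have supp: "((\<lambda>n. \<Sum>k. A n k * x k) \<longlongrightarrow> 0) (ideal_filter J)"
      if "\<And>k. k \<notin> E \<Longrightarrow> x k = 0" "\<And>k. \<bar>x k\<bar> \<le> 1" for x
    proof (rule reg(3))
      show "(x \<longlongrightarrow> 0) (ideal_filter I)"
        using I \<open>E \<in> I\<close> that(1) by (rule tendsto_zero_ideal_filter_if_supported)
      show "bounded (range x)" using that(2) by (auto simp: bounded_iff)
    qed
    consider "\<forall>n k. A n k \<ge> 0" | "I = Fin" | "J = Fin" using assms(3) by blast
    then show "((\<lambda>n. \<Sum>\<^sub>\<infinity>k\<in>E. \<bar>A n k\<bar>) \<longlongrightarrow> 0) (ideal_filter J)"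
    proof cases
      case 1
      \<comment> \<open>Without signs to cancel, the transform of the indicator is already the sum
        of absolute values.\<close>
      then show ?thesis
        using supp[of "indicator E"] unfolding infsum_abs_eq_suminf_indicator[OF rows] by simp
    next
      case 2
      then have "finite E" using \<open>E \<in> I\<close> by (simp add: Fin_def)
      have "((\<lambda>n. A n k) \<longlongrightarrow> 0) (ideal_filter J)" if "k \<in> E" for k
      proof -
        have "((\<lambda>n. \<Sum>i. A n i * indicator {k} i) \<longlongrightarrow> 0) (ideal_filter J)"
          by (rule supp) (use that in \<open>auto split: split_indicator\<close>)
        moreover have "(\<Sum>i. A n i * indicator {k} i) = A n k" for n
          by (subst suminf_finite[of "{k}"]) auto
        ultimately show ?thesis by simp
      qed
      \<comment> \<open>For finite \<open>E\<close> the limit passes through the sum column by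
        column.\<close>
      then have "((\<lambda>n. \<Sum>k\<in>E. \<bar>A n k\<bar>) \<longlongrightarrow> (\<Sum>k\<in>E. \<bar>0\<bar>)) (ideal_filter J)"
        by (intro tendsto_intros)
      then show ?thesis using \<open>finite E\<close> by simp
    next
      case 3
      \<comment> \<open>Schur's theorem for \<open>A\<close> with the columns outside
        \<open>E\<close> set to zero: cutting any bounded \<open>x\<close> down to \<open>E\<close>
        gives an \<open>I\<close>-null test sequence, and limits along \<open>Fin\<close> are
        ordinary ones.\<close>
      have "(\<lambda>n. \<Sum>k. \<bar>A n k * indicator E k\<bar>) \<longlonglongrightarrow> 0"
      proof (rule schur)
        show "summable (\<lambda>k. \<bar>A n k * indicator E k\<bar>)" for n
          by (rule summable_abs_mult_bounded[where M = 1])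
            (use rows in \<open>auto split: split_indicator\<close>)
        fix x :: "nat \<Rightarrow> real" assume "\<And>k. \<bar>x k\<bar> \<le> 1"
        then have "((\<lambda>n. \<Sum>k. A n k * (indicator E k * x k)) \<longlongrightarrow> 0) (ideal_filter J)"
          by (intro supp) (auto split: split_indicator)
        then show "(\<lambda>n. \<Sum>k. A n k * indicator E k * x k) \<longlonglongrightarrow> 0"
          using 3 J by (simp add: ideal_filter_Fin mult.assoc)
      qed
      then show ?thesis
        using 3 J by (simp add: ideal_filter_Fin infsum_abs_eq_suminf_indicator[OF rows] abs_mult)
    qed
  qed
  ultimately show "T1 A \<and> T2 J A \<and> T3 I J A" by blast
next
  assume "T1 A \<and> T2 J A \<and> T3 I J A"
  then show "ideal_regular I J A"
    using regular_if_T1_T2_T3[OF assms(1,2)] by blast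
qed

end
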